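(* The family of all connected graphs with at most one cycle is not forcing; that is, there exist graphons $U$ and $W$ that are not weakly isomorphic but satisfy $t(F,U)=t(F,W)$ for every finite connected graph $F$ containing at most one cycle. In particular, the family of all cycles $\{C_k : k\ge 3\}$ is not forcing.
   Context: A graphon is a measurable symmetric function $W:[0,1]^2\to[0,1]$ (Lebesgue measure on $[0,1]$). The homomorphism density of a graph $F$ on $\{1,\dots,k\}$ in $W$ is $t(F,W)=\int_{[0,1]^k}\prod_{\{i,j\}\in E(F)}W(x_i,x_j)\,dx_1\cdots dx_k$. The $k$-sample $\mathbb G(k,W)$ is the random graph on $\{1,\dots,k\}$ obtained by sampling $x_1,\dots,x_k\in[0,1]$ uniformly at random and making each pair $\{i,j\}$ with $i\neq j$ an edge with probability $W(x_i,x_j)$, all these choices being mutually independent. Two graphons $U,W$ are weakly isomorphic if $\mathbb G(k,U)$ and $\mathbb G(k,W)$ have the same distribution for every $k\in\mathbb N$ (equivalently, $t(H,U)=t(H,W)$ for every connected graph $H$). A family $\mathcal F$ of graphs is forcing if any two graphons $U,W$ with $t(F,U)=t(F,W)$ for all $F\in\mathcal F$ are weakly isomorphic. Graphs are finite and simple. *)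

theory Defs
  imports "HOL-Probability.Probability"
begin

type_synonym ugraph = "nat set \<times> nat set set"

abbreviation verts :: "ugraph \<Rightarrow> nat set" where "verts \<equiv> fst"
abbreviation edges :: "ugraph \<Rightarrow> nat set set" where "edges \<equiv> snd"

definition vertex_pairs :: "nat set \<Rightarrow> nat set set" where
  "vertex_pairs V = {e. e \<subseteq> V \<and> card e = 2}"

definition simple_graph :: "ugraph \<Rightarrow> bool" where
  "simple_graph G \<longleftrightarrow> finite (verts G) \<and> edges G \<subseteq> vertex_pairs (verts G)"

definition connected_graph :: "ugraph \<Rightarrow> bool" where
  "connected_graph G \<longleftrightarrow> verts G \<noteq> {} \<and>
     (\<forall>u\<in>verts G. \<forall>v\<in>verts G. (u, v) \<in> {(a, b). {a, b} \<in> edges G}\<^sup>*)"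

definition closed_path_edges :: "nat list \<Rightarrow> nat set set" where
  "closed_path_edges vs = {{vs ! i, vs ! (Suc i mod length vs)} | i. i < length vs}"

(* A cycle in a graph is a subgraph; it has no isolated vertices, hence it is
   determined by its edge set. Hence two vertex sequences that differ by a
   rotation or a reversal count as the same cycle. *)
definition cycles_in :: "ugraph \<Rightarrow> nat set set set" where
  "cycles_in G = {closed_path_edges vs | vs.
     3 \<le> length vs \<and> distinct vs \<and> closed_path_edges vs \<subseteq> edges G}"

definition at_most_one_cycle :: "ugraph \<Rightarrow> bool" where
  "at_most_one_cycle G \<longleftrightarrow> (\<forall>C\<in>cycles_in G. \<forall>D\<in>cycles_in G. C = D)"

definition cycle_graph :: "nat \<Rightarrow> ugraph" where
  "cycle_graph k = ({1..k}, closed_path_edges [1..<Suc k])"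

abbreviation unit_lebesgue :: "real measure" where
  "unit_lebesgue \<equiv> restrict_space lborel {0..1}"

(* Measurability is Borel measurability. The values of W outside the unit
   square are irrelevant. *)
definition graphon :: "(real \<Rightarrow> real \<Rightarrow> real) \<Rightarrow> bool" where
  "graphon W \<longleftrightarrow>
     (\<lambda>(x, y). W x y) \<in> borel_measurable (unit_lebesgue \<Otimes>\<^sub>M unit_lebesgue) \<and>
     (\<forall>x\<in>{0..1}. \<forall>y\<in>{0..1}. W x y = W y x \<and> W x y \<in> {0..1})"

(* W(x_i, x_j) for the edge e = {i, j}; as W is symmetric, the choice of the
   order of i and j made here is immaterial. *)
definition edge_weight :: "(real \<Rightarrow> real \<Rightarrow> real) \<Rightarrow> (nat \<Rightarrow> real) \<Rightarrow> nat set \<Rightarrow> real" where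
  "edge_weight W x e = W (x (Min e)) (x (Max e))"

definition hom_density :: "ugraph \<Rightarrow> (real \<Rightarrow> real \<Rightarrow> real) \<Rightarrow> real" where
  "hom_density F W =
     (\<integral>x. (\<Prod>e\<in>edges F. edge_weight W x e) \<partial>(\<Pi>\<^sub>M i\<in>verts F. unit_lebesgue))"

definition random_graph_pmf :: "nat set \<Rightarrow> (nat set \<Rightarrow> real) \<Rightarrow> ugraph pmf" where
  "random_graph_pmf V p =
     map_pmf (\<lambda>b. (V, {e \<in> vertex_pairs V. b e}))
       (Pi_pmf (vertex_pairs V) False (\<lambda>e. bernoulli_pmf (p e)))"

definition graphon_sample :: "nat \<Rightarrow> (real \<Rightarrow> real \<Rightarrow> real) \<Rightarrow> ugraph measure" where
  "graphon_sample k W =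
     (\<Pi>\<^sub>M i\<in>{1..k}. unit_lebesgue) \<bind>
       (\<lambda>x. measure_pmf (random_graph_pmf {1..k} (edge_weight W x)))"

definition weakly_isomorphic :: "(real \<Rightarrow> real \<Rightarrow> real) \<Rightarrow> (real \<Rightarrow> real \<Rightarrow> real) \<Rightarrow> bool" where
  "weakly_isomorphic U W \<longleftrightarrow> (\<forall>k. graphon_sample k U = graphon_sample k W)"

definition forcing :: "ugraph set \<Rightarrow> bool" where
  "forcing \<F> \<longleftrightarrow>
     (\<forall>U W. graphon U \<longrightarrow> graphon W \<longrightarrow>
        (\<forall>F\<in>\<F>. hom_density F U = hom_density F W) \<longrightarrow> weakly_isomorphic U W)"

end

(* For f with values in [-1, 1] consider W(x, y) = 1/2 + f(x) f(y) / 2. Expanding the product over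
   the edges, t(F, W) is 2^(-|E(F)|) times the sum over S \<subseteq> E(F) of the product over the vertices v of
   the moments of f of order deg_S(v). If f has mean zero, only the S without leaves contribute; if F
   has at most one cycle, such an S is 2-regular, so t(F, W) depends on the variance of f only. The
   third moment enters through K_4 minus an edge. A symmetric and a skew two-valued f of mean zero
   with equal variances therefore give the required pair of graphons. *)
theory Submission
  imports Defs
begin

subsection \<open>Degrees and cycles\<close>

definition edge_degree :: "nat set set \<Rightarrow> nat \<Rightarrow> nat" where
  "edge_degree S v = card {e \<in> S. v \<in> e}"

lemma finite_vertex_pairs: "finite V \<Longrightarrow> finite (vertex_pairs V)"
  by (rule finite_subset[of _ "Pow V"]) (auto simp: vertex_pairs_def)

lemma edge_degree_mono:
  assumes "finite T" "S \<subseteq> T"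
  shows "edge_degree S v \<le> edge_degree T v"
  unfolding edge_degree_def using assms by (intro card_mono) auto

text \<open>Handshake lemma by double counting of incidences; it turns a bound on the number of
  edges into a bound on the average degree.\<close>

lemma sum_edge_degree:
  assumes V: "finite V" and S: "S \<subseteq> vertex_pairs V"
  shows "(\<Sum>v\<in>V. edge_degree S v) = 2 * card S"
proof -
  have fS: "finite S" using finite_subset[OF S finite_vertex_pairs[OF V]] .
  have "(\<Sum>v\<in>V. edge_degree S v) = (\<Sum>v\<in>V. \<Sum>e\<in>S. if v \<in> e then 1 else 0)"
    using fS by (simp add: edge_degree_def sum.If_cases Int_def)
  also have "\<dots> = (\<Sum>e\<in>S. \<Sum>v\<in>V. if v \<in> e then 1 else 0)"
    by (rule sum.swap)
  also have "\<dots> = (\<Sum>e\<in>S. 2)"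
  proof (rule sum.cong)
    fix e assume "e \<in> S"
    then have e: "e \<subseteq> V" "card e = 2" using S by (auto simp: vertex_pairs_def)
    then have "{v \<in> V. v \<in> e} = e" by auto
    then show "(\<Sum>v\<in>V. if v \<in> e then 1 else 0) = (2::nat)"
      using V e by (simp add: sum.If_cases Int_def)
  qed simp
  finally show ?thesis by simp
qed

text \<open>The end of a longest path has a second neighbour, which lies on the path by maximality.\<close>

lemma cycle_if_no_leaf:
  assumes V: "finite V" and S: "S \<subseteq> vertex_pairs V" "S \<noteq> {}"
    and no_leaf: "\<And>v. edge_degree S v \<noteq> 1"
  obtains vs where "3 \<le> length vs" "distinct vs" "closed_path_edges vs \<subseteq> S"
proof -
  \<comment> \<open>At least two vertices are required so that each vertex of a path lies on an edge
    of \<open>S\<close>, hence in \<open>V\<close>. This bounds the length of paths, so a longest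
    one exists.\<close>
  define path where "path vs \<longleftrightarrow> 2 \<le> length vs \<and> distinct vs \<and>
    (\<forall>i. Suc i < length vs \<longrightarrow> {vs ! i, vs ! Suc i} \<in> S)" for vs
  have path_V: "set vs \<subseteq> V" if p: "path vs" for vs
  proof
    fix v assume "v \<in> set vs"
    then obtain i where i: "i < length vs" "v = vs ! i" by (auto simp: in_set_conv_nth)
    have "\<exists>e\<in>S. v \<in> e"
    proof (cases "Suc i < length vs")
      case True
      then show ?thesis using p i by (auto simp: path_def)
    next
      case False
      then have "i = Suc (i - 1)" "Suc (i - 1) < length vs" using p i by (auto simp: path_def)
      then have "{vs ! (i - 1), vs ! i} \<in> S" using p unfolding path_def by metis
      then show ?thesis using i by auto
    qed
    then show "v \<in> V" using S by (auto simp: vertex_pairs_def)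
  qed
  have bound: "length vs < Suc (card V)" if p: "path vs" for vs
  proof -
    have "length vs = card (set vs)" using p by (simp add: path_def distinct_card)
    also have "\<dots> \<le> card V" using path_V[OF p] V by (rule card_mono[rotated])
    finally show ?thesis by simp
  qed
  obtain e where e: "e \<in> S" using S by auto
  then have "card e = 2" using S by (auto simp: vertex_pairs_def)
  then obtain a b where "e = {a, b}" "a \<noteq> b" by (auto simp: card_2_iff)
  then have "path [a, b]" using e by (auto simp: path_def less_Suc_eq)
  moreover have "\<forall>vs. path vs \<longrightarrow> length vs < Suc (card V)" using bound by blast
  ultimately obtain vs where vs: "path vs" and max: "\<And>ws. path ws \<Longrightarrow> length ws \<le> length vs"
    using ex_has_greatest_nat[of path "[a, b]" length "Suc (card V)"] by auto
  obtain x y zs where xy: "vs = x # y # zs"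
    using vs unfolding path_def by (metis Suc_le_length_iff numeral_2_eq_2)
  have "{vs ! 0, vs ! Suc 0} \<in> S" using vs xy unfolding path_def
    by (metis length_Cons zero_less_Suc Suc_less_eq)
  then have xyS: "{x, y} \<in> S" by (simp add: xy)
  have "\<exists>e'\<in>S. x \<in> e' \<and> e' \<noteq> {x, y}"
  proof (rule ccontr)
    assume "\<not> ?thesis"
    then have "{e \<in> S. x \<in> e} = {{x, y}}" using xyS by blast
    then show False using no_leaf[of x] by (simp add: edge_degree_def)
  qed
  then obtain e' where e': "e' \<in> S" "x \<in> e'" "e' \<noteq> {x, y}" by auto
  then have "card e' = 2" using S by (auto simp: vertex_pairs_def)
  then obtain w where w: "e' = {x, w}" "w \<noteq> x"
    using e'(2) by (auto simp: card_2_iff)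
  have wy: "w \<noteq> y" using w e' by auto
  have "w \<in> set vs"
  proof (rule ccontr)
    assume nw: "w \<notin> set vs"
    have "{(w # vs) ! i, (w # vs) ! Suc i} \<in> S" if "Suc i < length (w # vs)" for i
    proof (cases i)
      case 0
      then show ?thesis using w e' by (simp add: xy insert_commute)
    next
      case (Suc j)
      then show ?thesis using vs that by (auto simp: path_def)
    qed
    then have "path (w # vs)" using vs nw by (auto simp: path_def)
    from max[OF this] show False by simp
  qed
  then obtain j where j: "j < length vs" "vs ! j = w" by (auto simp: in_set_conv_nth)
  \<comment> \<open>The neighbour \<open>w\<close> differs from the first two vertices
    \<open>x\<close> and \<open>y\<close>. So the prefix of the path ending in \<open>w\<close> has
    at least three vertices, and the edge \<open>{w, x}\<close> closes it to a cycle.\<close>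
  have j2: "2 \<le> j"
  proof (rule ccontr)
    assume "\<not> 2 \<le> j"
    then have "j = 0 \<or> j = 1" by auto
    then show False using j w wy by (auto simp: xy)
  qed
  define c where "c = take (Suc j) vs"
  have len: "length c = Suc j" using j by (simp add: c_def)
  have nth: "c ! i = vs ! i" if "i \<le> j" for i using that by (simp add: c_def)
  show thesis
  proof
    show "3 \<le> length c" using len j2 by simp
    show "distinct c" using vs by (simp add: c_def path_def)
    show "closed_path_edges c \<subseteq> S"
    proof
      fix d assume "d \<in> closed_path_edges c"
      then obtain i where i: "i < length c" "d = {c ! i, c ! (Suc i mod length c)}"
        by (auto simp: closed_path_edges_def)
      show "d \<in> S"
      proof (cases "i = j")
        case True
        then have "d = {w, x}" using i j len by (simp add: nth xy)
        then show ?thesis using w e' by (simp add: insert_commute)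
      next
        case False
        then have "i < j" using i len by simp
        then have "d = {vs ! i, vs ! Suc i}" using i len by (simp add: nth)
        then show ?thesis using vs j \<open>i < j\<close> by (simp add: path_def)
      qed
    qed
  qed
qed

text \<open>Without a cycle there is a leaf \<open>v\<close>. Deleting its only edge costs one edge
  and uncovers at least the vertex \<open>v\<close>, so induction applies, down to a single edge,
  which covers two vertices.\<close>

lemma acyclic_card_edges:
  assumes V: "finite V" and S: "S \<subseteq> vertex_pairs V" "S \<noteq> {}"
    and acyclic: "\<And>vs. 3 \<le> length vs \<Longrightarrow> distinct vs \<Longrightarrow> \<not> closed_path_edges vs \<subseteq> S"
  shows "card S < card (\<Union>S)"
proof -
  have fS: "finite S" using finite_subset[OF S(1) finite_vertex_pairs[OF V]] .
  from fS S acyclic show ?thesis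
  proof (induction S rule: finite_psubset_induct)
    case (psubset S)
    obtain v where "edge_degree S v = 1"
      using cycle_if_no_leaf[OF V psubset.prems(1,2)] psubset.prems(3) by metis
    then obtain e where e: "{e \<in> S. v \<in> e} = {e}"
      unfolding edge_degree_def by (rule card_1_singletonE)
    then have eS: "e \<in> S" "v \<in> e" by auto
    have ce: "card e = 2" using eS psubset.prems(1) by (auto simp: vertex_pairs_def)
    have fU: "finite (\<Union>S)"
      using psubset.prems(1) V by (auto intro: finite_subset[of _ V] simp: vertex_pairs_def)
    show ?case
    proof (cases "S - {e} = {}")
      case True
      then have "S = {e}" using eS by auto
      then show ?thesis using ce by simp
    next
      case False
      have "card (S - {e}) < card (\<Union>(S - {e}))"
      proof (rule psubset.IH)
        show "\<not> closed_path_edges vs \<subseteq> S - {e}" if "3 \<le> length vs" "distinct vs" for vs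
          using psubset.prems(3)[OF that] by blast
      qed (use eS psubset.prems False in auto)
      moreover have "card (\<Union>(S - {e})) < card (\<Union>S)"
      proof (rule psubset_card_mono[OF fU])
        show "\<Union>(S - {e}) \<subset> \<Union>S" using e eS by blast
      qed
      moreover have "card S = Suc (card (S - {e}))"
        using psubset.hyps eS(1) by (rule card.remove)
      ultimately show ?thesis by simp
    qed
  qed
qed

text \<open>Deleting an edge of the only cycle leaves a forest, so there are at most as many edges
  as vertices. Hence the average degree is at most 2, which is also the minimum degree.\<close>

lemma at_most_one_cycle_degree:
  assumes F: "simple_graph F" "at_most_one_cycle F" and S: "S \<subseteq> edges F"
    and no_leaf: "\<And>v. edge_degree S v \<noteq> 1"
  shows "edge_degree S v \<le> 2"
proof (cases "S = {}")
  case True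
  then show ?thesis by (simp add: edge_degree_def)
next
  case False
  let ?V = "verts F"
  have V: "finite ?V" and SV: "S \<subseteq> vertex_pairs ?V" using F S by (auto simp: simple_graph_def)
  have fS: "finite S" using finite_subset[OF SV finite_vertex_pairs[OF V]] .
  obtain vs where vs: "3 \<le> length vs" "distinct vs" "closed_path_edges vs \<subseteq> S"
    using cycle_if_no_leaf[OF V SV False no_leaf] .
  have "{vs ! 0, vs ! (Suc 0 mod length vs)} \<in> closed_path_edges vs"
    using vs(1) by (force simp: closed_path_edges_def)
  then obtain e where e: "e \<in> closed_path_edges vs" by auto
  have "card (S - {e}) < card (\<Union>(S - {e}))"
  proof (rule acyclic_card_edges[OF V])
    show "S - {e} \<subseteq> vertex_pairs ?V" using SV by auto
    show "S - {e} \<noteq> {}"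
    proof
      assume "S - {e} = {}"
      then have Se: "S = {e}" using e vs(3) by auto
      then have "card e = 2" using SV by (auto simp: vertex_pairs_def)
      then obtain w where "w \<in> e" by fastforce
      then have "{d \<in> S. w \<in> d} = {e}" using Se by auto
      then show False using no_leaf[of w] by (simp add: edge_degree_def)
    qed
    show "\<not> closed_path_edges ws \<subseteq> S - {e}" if ws: "3 \<le> length ws" "distinct ws" for ws
    proof
      assume sub: "closed_path_edges ws \<subseteq> S - {e}"
      have "closed_path_edges ws \<in> cycles_in F" "closed_path_edges vs \<in> cycles_in F"
        using ws vs sub S unfolding cycles_in_def by blast+
      then have "closed_path_edges ws = closed_path_edges vs"
        using F(2) by (auto simp: at_most_one_cycle_def)
      then show False using e sub by auto
    qed
  qed
  moreover have UV: "\<Union>S \<subseteq> ?V" using SV by (auto simp: vertex_pairs_def)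
  then have fU: "finite (\<Union>S)" using V finite_subset by blast
  moreover have "card (\<Union>(S - {e})) \<le> card (\<Union>S)" using fU by (intro card_mono) auto
  moreover have "card S = Suc (card (S - {e}))"
    using fS e vs(3) by (auto intro: card.remove)
  ultimately have le: "card S \<le> card (\<Union>S)" by simp
  have ge: "2 \<le> edge_degree S w" if w: "w \<in> \<Union>S" for w
  proof -
    have "edge_degree S w \<noteq> 0" using w fS by (auto simp: edge_degree_def)
    then show ?thesis using no_leaf[of w] by linarith
  qed
  \<comment> \<open>The degrees are summed over the covered vertices only, as the lower bound 2
    holds only there. A sum of at most twice their number then leaves no room for a degree above
    2.\<close>
  have "S \<subseteq> vertex_pairs (\<Union>S)" using SV by (auto simp: vertex_pairs_def)
  from sum_edge_degree[OF fU this] have sum: "(\<Sum>w\<in>\<Union>S. edge_degree S w) \<le> 2 * card (\<Union>S)"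
    using le by simp
  show ?thesis
  proof (cases "v \<in> \<Union>S")
    case True
    have "(\<Sum>w\<in>\<Union>S - {v}. 2) \<le> (\<Sum>w\<in>\<Union>S - {v}. edge_degree S w)"
      using ge by (intro sum_mono) auto
    moreover have "(\<Sum>w\<in>\<Union>S. edge_degree S w) = edge_degree S v + (\<Sum>w\<in>\<Union>S - {v}. edge_degree S w)"
      using fU True by (rule sum.remove)
    moreover have "card (\<Union>S) = Suc (card (\<Union>S - {v}))"
      using fU True by (rule card.remove)
    ultimately show ?thesis using sum by simp
  next
    case False
    then have "{e \<in> S. v \<in> e} = {}" by auto
    then show ?thesis by (simp only: edge_degree_def) simp
  qed
qed

section \<open>Cycle graphs: simplicity and maximum degree\<close>

lemma simple_cycle_graph:
  assumes "3 \<le> k"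
  shows "simple_graph (cycle_graph k)"
proof -
  have "e \<in> vertex_pairs {1..k}" if e: "e \<in> closed_path_edges [1..<Suc k]" for e
  proof -
    obtain i where "e = {[1..<Suc k] ! i, [1..<Suc k] ! (Suc i mod length [1..<Suc k])} \<and>
        i < length [1..<Suc k]"
      using e unfolding closed_path_edges_def mem_Collect_eq ..
    then have i: "i < k" "e = {[1..<Suc k] ! i, [1..<Suc k] ! (Suc i mod k)}"
      by (simp_all del: upt_Suc nth_upt)
    \<comment> \<open>The vertex at position \<open>i\<close> is \<open>Suc i\<close>. Cyclically
      consecutive positions differ, so each edge has two elements.\<close>
    have m: "Suc i mod k < k" "Suc i mod k \<noteq> i"
      using i(1) assms by (auto simp: mod_Suc)
    then have "e = {Suc i, Suc (Suc i mod k)}" using i by (simp del: upt_Suc)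
    moreover have "Suc (Suc i mod k) \<le> k" using m(1) by (rule Suc_leI)
    ultimately show ?thesis using m(2) i(1) by (auto simp: vertex_pairs_def)
  qed
  then show ?thesis by (auto simp: simple_graph_def cycle_graph_def)
qed

text \<open>Each vertex is the first end of at most one listed edge and the second end of at most
  one. For cycles this replaces the count of cycles in the graph: edge subsets inherit the degree
  bound.\<close>

lemma cycle_graph_degree: "edge_degree (edges (cycle_graph k)) v \<le> 2"
proof -
  define vs where "vs = [1..<Suc k]"
  have len: "length vs = k" and dist: "distinct vs" by (auto simp: vs_def)
  define g where "g i = {vs ! i, vs ! (Suc i mod k)}" for i
  let ?A = "{i. i < k \<and> v \<in> g i}"
  have inj: "i = j" if "i < k" "j < k" "vs ! i = vs ! j" for i j
    using that dist len by (simp add: nth_eq_iff_index_eq)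
  have inj_succ: "i = j" if "i < k" "j < k" "Suc i mod k = Suc j mod k" for i j
    using that by (auto simp: mod_Suc split: if_splits)
  have card1: "card X \<le> Suc 0" if *: "\<forall>i\<in>X. \<forall>j\<in>X. i = j" for X :: "nat set"
  proof -
    obtain x where "X \<subseteq> {x}" using * by blast
    then show ?thesis using card_mono[of "{x}" X] by simp
  qed
  let ?B = "{i. i < k \<and> vs ! i = v}" and ?C = "{i. i < k \<and> vs ! (Suc i mod k) = v}"
  have "card ?B \<le> Suc 0" using inj by (intro card1) blast
  moreover have "card ?C \<le> Suc 0"
  proof (intro card1 ballI)
    fix i j assume "i \<in> ?C" "j \<in> ?C"
    then have ij: "i < k" "j < k" "vs ! (Suc i mod k) = vs ! (Suc j mod k)" by auto
    moreover have "Suc i mod k < k" "Suc j mod k < k" using ij by auto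
    ultimately show "i = j" using inj inj_succ by blast
  qed
  moreover have "{e \<in> closed_path_edges vs. v \<in> e} \<subseteq> g ` (?B \<union> ?C)"
    unfolding closed_path_edges_def len g_def by auto
  then have "card {e \<in> closed_path_edges vs. v \<in> e} \<le> card (g ` (?B \<union> ?C))"
    by (intro card_mono) auto
  then have "card {e \<in> closed_path_edges vs. v \<in> e} \<le> card (?B \<union> ?C)"
    using card_image_le[of "?B \<union> ?C" g] by simp
  then have "card {e \<in> closed_path_edges vs. v \<in> e} \<le> card ?B + card ?C"
    using card_Un_le le_trans by blast
  ultimately show ?thesis by (simp add: edge_degree_def cycle_graph_def vs_def)
qed

subsection \<open>Homomorphism densities of rank-one perturbations\<close>

abbreviation unit_moment :: "(real \<Rightarrow> real) \<Rightarrow> nat \<Rightarrow> real" where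
  "unit_moment f k \<equiv> \<integral>x. f x ^ k \<partial>unit_lebesgue"

definition rank_one_graphon :: "(real \<Rightarrow> real) \<Rightarrow> real \<Rightarrow> real \<Rightarrow> real" where
  "rank_one_graphon f x y = 1 / 2 + 1 / 2 * (f x * f y)"

interpretation unit: prob_space unit_lebesgue
  by (rule prob_spaceI) (simp add: emeasure_restrict_space space_restrict_space)

interpretation unit_prod: product_prob_space "\<lambda>i :: nat. unit_lebesgue" UNIV
  by unfold_locales

lemma graphon_rank_one:
  assumes [measurable]: "f \<in> borel_measurable unit_lebesgue" and bound: "\<And>x. \<bar>f x\<bar> \<le> 1"
  shows "graphon (rank_one_graphon f)"
  unfolding graphon_def
proof (intro conjI ballI)
  show "(\<lambda>(x, y). rank_one_graphon f x y) \<in> borel_measurable (unit_lebesgue \<Otimes>\<^sub>M unit_lebesgue)"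
    unfolding rank_one_graphon_def by measurable
  fix x y :: real
  show "rank_one_graphon f x y = rank_one_graphon f y x"
    by (simp add: rank_one_graphon_def)
  have "\<bar>f x * f y\<bar> \<le> 1 * 1"
    unfolding abs_mult using bound by (intro mult_mono) auto
  then show "rank_one_graphon f x y \<in> {0..1}"
    by (auto simp: rank_one_graphon_def abs_le_iff)
qed

text \<open>Expanding the product over the edges, the subset \<open>S\<close> collects the edges at which
  the factor \<open>f x * f y / 2\<close> is chosen.\<close>

lemma hom_density_rank_one:
  assumes F: "simple_graph F"
    and [measurable]: "f \<in> borel_measurable unit_lebesgue" and bound: "\<And>x. \<bar>f x\<bar> \<le> 1"
  shows "hom_density F (rank_one_graphon f) =
    (1 / 2) ^ card (edges F) *
      (\<Sum>S\<in>Pow (edges F). \<Prod>v\<in>verts F. unit_moment f (edge_degree S v))"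
proof -
  let ?V = "verts F" and ?E = "edges F"
  let ?P = "\<Pi>\<^sub>M i\<in>?V. unit_lebesgue"
  have V: "finite ?V" and E: "?E \<subseteq> vertex_pairs ?V" using F by (auto simp: simple_graph_def)
  have fE: "finite ?E" using finite_subset[OF E finite_vertex_pairs[OF V]] .
  have intf: "integrable unit_lebesgue (\<lambda>x. f x ^ k)" for k
    using bound by (intro unit.integrable_const_bound[where B = 1]) (auto simp: power_abs power_le_one)
  \<comment> \<open>Regrouping by vertices: \<open>v\<close> receives one factor
    \<open>f (x v)\<close> from each edge of \<open>S\<close> at \<open>v\<close>.\<close>
  have factor: "(\<Prod>e\<in>S. f (x (Min e)) * f (x (Max e))) = (\<Prod>v\<in>?V. f (x v) ^ edge_degree S v)"
    if S: "S \<subseteq> ?E" for S x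
  proof -
    have fS: "finite S" using S fE finite_subset by blast
    have "(\<Prod>e\<in>S. f (x (Min e)) * f (x (Max e))) = (\<Prod>e\<in>S. \<Prod>v\<in>?V. if v \<in> e then f (x v) else 1)"
    proof (rule prod.cong)
      fix e assume "e \<in> S"
      then have e: "e \<subseteq> ?V" "card e = 2" using S E by (auto simp: vertex_pairs_def)
      then obtain a b where ab: "e = {a, b}" "a \<noteq> b" by (auto simp: card_2_iff)
      have "(\<Prod>v\<in>?V. if v \<in> e then f (x v) else 1) = (\<Prod>v\<in>e. f (x v))"
        using V e by (simp add: prod.If_cases Int_absorb1)
      also have "\<dots> = f (x (Min e)) * f (x (Max e))"
        using ab by (cases "a < b") (auto simp: min_def max_def)
      finally show "f (x (Min e)) * f (x (Max e)) = (\<Prod>v\<in>?V. if v \<in> e then f (x v) else 1)" ..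
    qed simp
    also have "\<dots> = (\<Prod>v\<in>?V. \<Prod>e\<in>S. if v \<in> e then f (x v) else 1)"
      by (rule prod.swap)
    also have "\<dots> = (\<Prod>v\<in>?V. f (x v) ^ edge_degree S v)"
      using fS by (simp add: prod.If_cases Int_def edge_degree_def)
    finally show ?thesis .
  qed
  have expand: "(\<Prod>e\<in>?E. edge_weight (rank_one_graphon f) x e) =
    (\<Sum>S\<in>Pow ?E. (1 / 2) ^ card ?E * (\<Prod>v\<in>?V. f (x v) ^ edge_degree S v))" for x
  proof -
    have "(\<Prod>e\<in>?E. edge_weight (rank_one_graphon f) x e) =
      (1 / 2) ^ card ?E * (\<Prod>e\<in>?E. f (x (Min e)) * f (x (Max e)) + 1)"
      by (simp add: edge_weight_def rank_one_graphon_def algebra_simps flip: prod_constant prod.distrib)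
    also have "(\<Prod>e\<in>?E. f (x (Min e)) * f (x (Max e)) + 1) =
      (\<Sum>S\<in>Pow ?E. \<Prod>e\<in>S. f (x (Min e)) * f (x (Max e)))"
      by (subst prod_add[OF fE]) simp
    finally show ?thesis using factor by (simp add: sum_distrib_left)
  qed
  have integ: "integrable ?P (\<lambda>x. \<Prod>v\<in>?V. f (x v) ^ edge_degree S v)" for S
    using V intf by (intro unit_prod.product_integrable_prod)
  have "hom_density F (rank_one_graphon f) =
    (\<Sum>S\<in>Pow ?E. (1 / 2) ^ card ?E * (\<integral>x. (\<Prod>v\<in>?V. f (x v) ^ edge_degree S v) \<partial>?P))"
    unfolding hom_density_def expand using integ by simp
  also have "\<dots> = (1 / 2) ^ card ?E *
      (\<Sum>S\<in>Pow ?E. \<Prod>v\<in>?V. unit_moment f (edge_degree S v))"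
    unfolding unit_prod.product_integral_prod[OF V intf] by (simp add: sum_distrib_left)
  finally show ?thesis .
qed

text \<open>The two expansions agree term by term: a vertex of degree 1 makes both terms vanish, and
  otherwise only moments of order 0 and 2 occur. The assumption \<open>degrees\<close> isolates the
  graph theory, so that unicyclic graphs and cycle graphs share this argument.\<close>

lemma hom_density_rank_one_eq:
  assumes F: "simple_graph F"
    and f: "f \<in> borel_measurable unit_lebesgue" "\<And>x. \<bar>f x\<bar> \<le> 1"
    and g: "g \<in> borel_measurable unit_lebesgue" "\<And>x. \<bar>g x\<bar> \<le> 1"
    and centred: "unit_moment f 1 = 0" "unit_moment g 1 = 0"
    and variance: "unit_moment f 2 = unit_moment g 2"
    and degrees: "\<And>S v. S \<subseteq> edges F \<Longrightarrow> (\<And>v. edge_degree S v \<noteq> 1) \<Longrightarrow> edge_degree S v \<le> 2"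
  shows "hom_density F (rank_one_graphon f) = hom_density F (rank_one_graphon g)"
proof -
  have "(\<Prod>v\<in>verts F. unit_moment f (edge_degree S v)) =
      (\<Prod>v\<in>verts F. unit_moment g (edge_degree S v))" if S: "S \<subseteq> edges F" for S
  proof (cases "\<exists>v. edge_degree S v = 1")
    case True
    then obtain v where v: "edge_degree S v = 1" ..
    then obtain e where "{e \<in> S. v \<in> e} = {e}"
      unfolding edge_degree_def by (rule card_1_singletonE)
    then have "e \<in> S" "v \<in> e" by auto
    then have "v \<in> verts F" using S F by (auto simp: simple_graph_def vertex_pairs_def)
    moreover have "finite (verts F)" using F by (simp add: simple_graph_def)
    ultimately show ?thesis
      using v centred prod_zero[of "verts F"] by metis
  next
    case False
    show ?thesis
    proof (rule prod.cong)
      fix v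
      have "edge_degree S v \<le> 2" "edge_degree S v \<noteq> 1" using degrees[OF S] False by auto
      then have "edge_degree S v = 0 \<or> edge_degree S v = 2" by linarith
      then show "unit_moment f (edge_degree S v) = unit_moment g (edge_degree S v)"
        using variance by auto
    qed simp
  qed
  then show ?thesis
    using hom_density_rank_one[OF F f] hom_density_rank_one[OF F g] by (simp add: Pow_def)
qed

section \<open>Two-valued functions and their moments\<close>

definition two_step :: "real \<Rightarrow> real \<Rightarrow> real \<Rightarrow> real \<Rightarrow> real" where
  "two_step p a b x = (if x < p then a else b)"

lemma two_step_measurable: "two_step p a b \<in> borel_measurable unit_lebesgue"
  unfolding two_step_def[abs_def] by (intro measurable_restrict_space1) measurable

lemma unit_moment_two_step:
  assumes p: "0 \<le> p" "p \<le> 1"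
  shows "unit_moment (two_step p a b) k = p * a ^ k + (1 - p) * b ^ k"
proof -
  have "unit_moment (two_step p a b) k =
    (\<integral>x. a ^ k * indicator {0..<p} x + b ^ k * indicator {p..1} x \<partial>lborel)"
    using p by (subst integral_restrict_space)
      (auto simp: two_step_def indicator_def intro!: Bochner_Integration.integral_cong)
  also have "\<dots> = p * a ^ k + (1 - p) * b ^ k"
    using p by (subst Bochner_Integration.integral_add) auto
  finally show ?thesis .
qed

subsection \<open>Sampling\<close>

text \<open>The probability of any event is a polynomial in the finitely many edge probabilities,
  hence measurable in \<open>x\<close>. This makes the random graph a kernel, as the integral
  formula for the bind in \<open>graphon_sample\<close> requires.\<close>

lemma random_graph_kernel_measurable:
  assumes V: "finite V"
    and meas: "\<And>e. e \<in> vertex_pairs V \<Longrightarrow> (\<lambda>x. p x e) \<in> borel_measurable M"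
    and range: "\<And>x e. x \<in> space M \<Longrightarrow> e \<in> vertex_pairs V \<Longrightarrow> p x e \<in> {0..1}"
  shows "(\<lambda>x. measure_pmf (random_graph_pmf V (p x))) \<in> M \<rightarrow>\<^sub>M subprob_algebra (count_space UNIV)"
proof (rule measurable_subprob_algebra)
  let ?E = "vertex_pairs V"
  have fE: "finite ?E" by (rule finite_vertex_pairs[OF V])
  fix A :: "ugraph set"
  \<comment> \<open>Restricting to functions that are \<open>False\<close> off the vertex pairs
    makes the set of configurations finite and keeps all of the mass.\<close>
  define B where "B = (\<lambda>b. (V, {e \<in> ?E. b e})) -` A \<inter> PiE_dflt ?E False (\<lambda>_. UNIV)"
  have fB: "finite B" unfolding B_def by (intro finite_Int disjI2 finite_PiE_dflt fE) auto
  have "emeasure (measure_pmf (random_graph_pmf V (p x))) A =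
      ennreal (\<Sum>b\<in>B. \<Prod>e\<in>?E. if b e then p x e else 1 - p x e)" if x: "x \<in> space M" for x
  proof -
    let ?Q = "Pi_pmf ?E False (\<lambda>e. bernoulli_pmf (p x e))"
    have "emeasure (measure_pmf (random_graph_pmf V (p x))) A =
        emeasure (measure_pmf ?Q) ((\<lambda>b. (V, {e \<in> ?E. b e})) -` A)"
      by (simp add: random_graph_pmf_def map_pmf_rep_eq emeasure_distr)
    also have "\<dots> = emeasure (measure_pmf ?Q) B"
      using set_Pi_pmf_subset'[OF fE, of False "\<lambda>e. bernoulli_pmf (p x e)"]
      unfolding B_def by (intro emeasure_eq_AE) (auto simp: AE_measure_pmf_iff PiE_dflt_def subset_eq)
    also have "\<dots> = ennreal (\<Sum>b\<in>B. pmf ?Q b)"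
      using fB by (simp add: measure_pmf.emeasure_eq_measure measure_measure_pmf_finite)
    also have "(\<Sum>b\<in>B. pmf ?Q b) = (\<Sum>b\<in>B. \<Prod>e\<in>?E. if b e then p x e else 1 - p x e)"
    proof (rule sum.cong)
      fix b assume "b \<in> B"
      then have "\<forall>e. e \<notin> ?E \<longrightarrow> b e = False" by (auto simp: B_def PiE_dflt_def)
      then have "pmf ?Q b = (\<Prod>e\<in>?E. pmf (bernoulli_pmf (p x e)) (b e))"
        using fE by (simp add: pmf_Pi)
      also have "\<dots> = (\<Prod>e\<in>?E. if b e then p x e else 1 - p x e)"
      proof (rule prod.cong)
        fix e assume "e \<in> ?E"
        \<comment> \<open>The range assumption ensures that the Bernoulli distribution gives
          \<open>True\<close> exactly the mass \<open>p x e\<close>.\<close>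
        then have "0 \<le> p x e" "p x e \<le> 1" using range[OF x] by auto
        then show "pmf (bernoulli_pmf (p x e)) (b e) = (if b e then p x e else 1 - p x e)"
          by (cases "b e") auto
      qed simp
      finally show "pmf ?Q b = \<dots>" .
    qed simp
    finally show ?thesis .
  qed
  moreover have "(\<lambda>x. ennreal (\<Sum>b\<in>B. \<Prod>e\<in>?E. if b e then p x e else 1 - p x e)) \<in> borel_measurable M"
  proof (intro measurable_compose[OF _ measurable_ennreal] borel_measurable_sum borel_measurable_prod)
    fix b e assume "e \<in> ?E"
    then show "(\<lambda>x. if b e then p x e else 1 - p x e) \<in> borel_measurable M"
      using meas[of e] by (cases "b e") simp_all
  qed
  ultimately show "(\<lambda>x. emeasure (measure_pmf (random_graph_pmf V (p x))) A) \<in> borel_measurable M"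
    by (subst measurable_cong) auto
qed (auto intro: prob_space_imp_subprob_space prob_space_measure_pmf)

lemma prob_random_graph_contains:
  assumes V: "finite V" and E: "E \<subseteq> vertex_pairs V"
    and range: "\<And>e. e \<in> E \<Longrightarrow> p e \<in> {0..1}"
  shows "measure_pmf.prob (random_graph_pmf V p) {G. E \<subseteq> edges G} = (\<Prod>e\<in>E. p e)"
proof -
  let ?E = "vertex_pairs V"
  let ?Q = "Pi_pmf ?E False (\<lambda>e. bernoulli_pmf (p e))"
  \<comment> \<open>The event is a product set: pairs outside \<open>E\<close> are unconstrained and
    contribute the factor 1.\<close>
  let ?B = "\<lambda>e. if e \<in> E then {True} else UNIV"
  have fE: "finite ?E" by (rule finite_vertex_pairs[OF V])
  have "measure_pmf.prob (random_graph_pmf V p) {G. E \<subseteq> edges G} = measure_pmf.prob ?Q (Pi ?E ?B)"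
    using E by (auto simp: random_graph_pmf_def intro!: arg_cong[where f = "measure_pmf.prob ?Q"]
        split: if_splits)
  also have "\<dots> = (\<Prod>e\<in>?E. measure_pmf.prob (bernoulli_pmf (p e)) (?B e))"
    using fE by (rule measure_Pi_pmf_Pi)
  also have "\<dots> = (\<Prod>e\<in>?E. if e \<in> E then p e else 1)"
    using range by (intro prod.cong) (auto simp: measure_pmf_single)
  also have "\<dots> = (\<Prod>e\<in>E. p e)"
    using E fE by (simp add: prod.If_cases Int_absorb1)
  finally show ?thesis .
qed

section \<open>From the distribution of samples to homomorphism densities\<close>

lemma edge_weight_measurable:
  assumes W: "graphon W" and e: "e \<in> vertex_pairs V"
  shows "(\<lambda>x. edge_weight W x e) \<in> borel_measurable (\<Pi>\<^sub>M i\<in>V. unit_lebesgue)"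
proof -
  have "finite e" "e \<noteq> {}" using e by (auto simp: vertex_pairs_def intro: card_ge_0_finite)
  then have "Min e \<in> V" "Max e \<in> V" using e Min_in Max_in by (auto simp: vertex_pairs_def)
  then have "(\<lambda>x. (x (Min e), x (Max e))) \<in>
      (\<Pi>\<^sub>M i\<in>V. unit_lebesgue) \<rightarrow>\<^sub>M unit_lebesgue \<Otimes>\<^sub>M unit_lebesgue"
    by (intro measurable_Pair measurable_component_singleton)
  moreover have "(\<lambda>(x, y). W x y) \<in> borel_measurable (unit_lebesgue \<Otimes>\<^sub>M unit_lebesgue)"
    using W by (simp add: graphon_def)
  ultimately show ?thesis
    by (auto dest: measurable_compose simp: edge_weight_def)
qed

lemma edge_weight_range:
  assumes W: "graphon W" and e: "e \<in> vertex_pairs V" and x: "x \<in> space (\<Pi>\<^sub>M i\<in>V. unit_lebesgue)"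
  shows "edge_weight W x e \<in> {0..1}"
proof -
  have "finite e" "e \<noteq> {}" using e by (auto simp: vertex_pairs_def intro: card_ge_0_finite)
  then have "Min e \<in> V" "Max e \<in> V" using e Min_in Max_in by (auto simp: vertex_pairs_def)
  then have "x (Min e) \<in> {0..1}" "x (Max e) \<in> {0..1}"
    using x by (auto simp: space_PiM space_restrict_space PiE_def Pi_def)
  then show ?thesis using W by (simp add: graphon_def edge_weight_def)
qed

text \<open>Given the sampled points, the edges are independent, so all of \<open>E\<close> is
  present with conditional probability the product of the edge weights. Averaging over the points
  gives the density.\<close>

lemma prob_sample_contains:
  assumes W: "graphon W" and E: "E \<subseteq> vertex_pairs {1..k}"
  shows "emeasure (graphon_sample k W) {G. E \<subseteq> edges G} = ennreal (hom_density ({1..k}, E) W)"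
proof -
  let ?P = "\<Pi>\<^sub>M i\<in>{1..k}. unit_lebesgue"
  interpret P: prob_space ?P
    by (rule prob_space_PiM) (rule unit.prob_space_axioms)
  note range = edge_weight_range[OF W] and [measurable] = edge_weight_measurable[OF W]
  have "emeasure (graphon_sample k W) {G. E \<subseteq> edges G} =
      (\<integral>\<^sup>+x. emeasure (measure_pmf (random_graph_pmf {1..k} (edge_weight W x))) {G. E \<subseteq> edges G} \<partial>?P)"
    unfolding graphon_sample_def using range
    by (intro emeasure_bind[OF P.not_empty random_graph_kernel_measurable]) auto
  also have "\<dots> = (\<integral>\<^sup>+x. ennreal (\<Prod>e\<in>E. edge_weight W x e) \<partial>?P)"
    using E range by (intro nn_integral_cong)
      (auto simp: measure_pmf.emeasure_eq_measure intro!: arg_cong[where f = ennreal] prob_random_graph_contains)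
  also have "\<dots> = ennreal (\<integral>x. (\<Prod>e\<in>E. edge_weight W x e) \<partial>?P)"
  proof (rule nn_integral_eq_integral)
    have bounds: "(\<Prod>e\<in>E. edge_weight W x e) \<in> {0..1}" if "x \<in> space ?P" for x
      using range[OF _ that] E by (auto intro!: prod_nonneg prod_le_1)
    show "AE x in ?P. 0 \<le> (\<Prod>e\<in>E. edge_weight W x e)"
      using bounds by (intro AE_I2) auto
    show "integrable ?P (\<lambda>x. \<Prod>e\<in>E. edge_weight W x e)"
    proof (rule P.integrable_const_bound[where B = 1])
      show "AE x in ?P. norm (\<Prod>e\<in>E. edge_weight W x e) \<le> 1"
        using bounds by (intro AE_I2) (simp add: abs_le_iff)
      show "(\<lambda>x. \<Prod>e\<in>E. edge_weight W x e) \<in> borel_measurable ?P"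
        using E by (intro borel_measurable_prod) auto
    qed
  qed
  finally show ?thesis by (simp add: hom_density_def)
qed

text \<open>Used contrapositively: a single graph with different densities rules out weak
  isomorphism.\<close>

lemma weakly_isomorphic_hom_density:
  assumes U: "graphon U" and W: "graphon W" and iso: "weakly_isomorphic U W"
    and E: "E \<subseteq> vertex_pairs {1..k}"
  shows "hom_density ({1..k}, E) U = hom_density ({1..k}, E) W"
proof -
  \<comment> \<open>\<open>ennreal\<close> is injective only on nonnegative reals.\<close>
  have nonneg: "0 \<le> hom_density ({1..k}, E) X" if "graphon X" for X
    unfolding hom_density_def using edge_weight_range[OF that] E
    by (intro Bochner_Integration.integral_nonneg) (force intro!: prod_nonneg)
  have "graphon_sample k U = graphon_sample k W" using iso by (simp add: weakly_isomorphic_def)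
  then have "ennreal (hom_density ({1..k}, E) U) = ennreal (hom_density ({1..k}, E) W)"
    using prob_sample_contains[OF U E] prob_sample_contains[OF W E] by simp
  then show ?thesis using nonneg U W by simp
qed

subsection \<open>The two graphons\<close>

abbreviation diamond_edges :: "nat set set" where
  "diamond_edges \<equiv> {{1, 2}, {1, 3}, {1, 4}, {2, 3}, {2, 4}}"

text \<open>As a rewrite rule, this unfolds the sum over the 32 edge subsets of the diamond.\<close>

lemma sum_Pow_insert:
  assumes "finite A" "a \<notin> A"
  shows "sum h (Pow (insert a A)) = sum h (Pow A) + (\<Sum>S\<in>Pow A. h (insert a S))"
proof -
  have "inj_on (insert a) (Pow A)" using assms by (auto simp: inj_on_def)
  moreover have "Pow A \<inter> insert a ` Pow A = {}" using assms by auto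
  ultimately show ?thesis
    using assms by (simp add: Pow_insert sum.union_disjoint sum.reindex)
qed

text \<open>The leafless edge subsets are the empty set, two triangles, the 4-cycle and the whole
  diamond, in the order of the summands. In the whole diamond, vertices 1 and 2 have degree 3 while
  3 and 4 have degree 2; this yields the only term with a third moment.\<close>

lemma hom_density_diamond:
  assumes f: "f \<in> borel_measurable unit_lebesgue" "\<And>x. \<bar>f x\<bar> \<le> 1"
    and centred: "unit_moment f 1 = 0"
  shows "hom_density ({1..4}, diamond_edges) (rank_one_graphon f) =
    (1 + 2 * unit_moment f 2 ^ 3 + unit_moment f 2 ^ 4 + unit_moment f 2 ^ 2 * unit_moment f 3 ^ 2) / 32"
proof -
  have degree: "edge_degree S v = (\<Sum>e\<in>S. if v \<in> e then 1 else 0)" if "finite S" for S v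
    using that by (simp add: edge_degree_def sum.If_cases Int_def)
  have V: "{1..4} = {1, 2, 3, 4 :: nat}" by auto
  \<comment> \<open>Vertices of degree 0 contribute the integral of 1, which the simplifier turns
    into this measure.\<close>
  have total: "measure unit_lebesgue {0..1} = 1"
    using unit.prob_space by (simp add: space_restrict_space)
  have simple: "simple_graph ({1..4}, diamond_edges)"
    by (auto simp: simple_graph_def vertex_pairs_def)
  have "hom_density ({1..4}, diamond_edges) (rank_one_graphon f) = (1 / 2) ^ card diamond_edges *
      (\<Sum>S\<in>Pow diamond_edges. \<Prod>v\<in>{1..4}. unit_moment f (edge_degree S v))"
    using hom_density_rank_one[OF simple f] by simp
  also have "\<dots> = (1 + 2 * unit_moment f 2 ^ 3 + unit_moment f 2 ^ 4 + unit_moment f 2 ^ 2 * unit_moment f 3 ^ 2) / 32"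
    using centred
    by (simp add: V sum_Pow_insert degree doubleton_eq_iff total power2_eq_square
        eval_nat_numeral algebra_simps)
  finally show ?thesis .
qed

theorem proposition8:
  shows "\<not> forcing {F. simple_graph F \<and> connected_graph F \<and> at_most_one_cycle F} \<and>
    (\<exists>U W. graphon U \<and> graphon W \<and> \<not> weakly_isomorphic U W \<and>
       (\<forall>F. simple_graph F \<and> connected_graph F \<and> at_most_one_cycle F \<longrightarrow>
          hom_density F U = hom_density F W)) \<and>
    \<not> forcing {cycle_graph k | k. k \<ge> 3}"
proof -
  define f where "f = two_step (1 / 2) (1 / 2) (- 1 / 2)"
  \<comment> \<open>Mass 1/5 at 1 balances mass 4/5 at -1/4. The variance is 1/5 + 1/20 = 1/4, as
    for \<open>f\<close>, but the third moment is 1/5 - 1/80 = 3/16, while that of the symmetric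
    \<open>f\<close> is 0.\<close>
  define g where "g = two_step (1 / 5) 1 (- 1 / 4)"
  have f: "f \<in> borel_measurable unit_lebesgue" "\<And>x. \<bar>f x\<bar> \<le> 1"
    by (simp_all add: f_def two_step_measurable) (simp add: two_step_def)
  have g: "g \<in> borel_measurable unit_lebesgue" "\<And>x. \<bar>g x\<bar> \<le> 1"
    by (simp_all add: g_def two_step_measurable) (simp add: two_step_def)
  have moments: "unit_moment f 1 = 0" "unit_moment g 1 = 0"
      "unit_moment f 2 = 1 / 4" "unit_moment g 2 = 1 / 4"
      "unit_moment f 3 = 0" "unit_moment g 3 = 3 / 16"
    unfolding f_def g_def by (subst unit_moment_two_step; simp add: power2_eq_square power3_eq_cube)+
  let ?U = "rank_one_graphon f" and ?W = "rank_one_graphon g"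
  have U: "graphon ?U" and W: "graphon ?W" using f g by (auto intro: graphon_rank_one)
  have "diamond_edges \<subseteq> vertex_pairs {1..4}" by (auto simp: vertex_pairs_def)
  moreover have "hom_density ({1..4}, diamond_edges) ?U \<noteq> hom_density ({1..4}, diamond_edges) ?W"
    unfolding hom_density_diamond[OF f moments(1)] hom_density_diamond[OF g moments(2)] moments
    by (simp add: power2_eq_square)
  ultimately have not_iso: "\<not> weakly_isomorphic ?U ?W"
    using weakly_isomorphic_hom_density[OF U W] by blast
  note hom_eq = hom_density_rank_one_eq[OF _ f g moments(1,2)]
  have unicyclic: "hom_density F ?U = hom_density F ?W"
    if "simple_graph F" "at_most_one_cycle F" for F
    using that moments by (intro hom_eq at_most_one_cycle_degree) auto
  have cycle: "hom_density (cycle_graph k) ?U = hom_density (cycle_graph k) ?W" if k: "3 \<le> k" for k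
  proof (rule hom_eq)
    show simple: "simple_graph (cycle_graph k)" by (rule simple_cycle_graph[OF k])
    fix S v assume "S \<subseteq> edges (cycle_graph k)"
    moreover have "finite (edges (cycle_graph k))"
      using simple finite_subset[OF _ finite_vertex_pairs] by (auto simp: simple_graph_def)
    ultimately have "edge_degree S v \<le> edge_degree (edges (cycle_graph k)) v"
      by (intro edge_degree_mono)
    then show "edge_degree S v \<le> 2" using cycle_graph_degree le_trans by blast
  qed (use moments in simp)
  show ?thesis
    unfolding forcing_def using U W not_iso unicyclic cycle by blast
qed

end
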